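(* Let $m\ge 1$, let $(p_i(n))_{n\ge 0}$, $1\le i\le m$, be sequences of nonnegative real numbers, and let $(\tau_i(n))_{n\ge 0}$, $1\le i\le m$, be sequences of integers such that $\tau_i(n)\le n-1$ for all $n\ge 0$ and there exist $M_i>0$ such that $n-\tau_i(n)\le M_i$ for all $n\ge 0$, $1\le i\le m$. If for each $k=1,\dots,m$ $$\liminf_{n\to\infty}\sum_{i=1}^{m}\sum_{j=\tau_k(n)}^{n-1}p_i(j)>\left(\frac{M_k}{M_k+1}\right)^{M_k+1},$$ then all solutions of the difference equation $$\Delta x(n)+\sum_{i=1}^m p_i(n)\,x(\tau_i(n))=0,\qquad n\ge 0,$$ oscillate.
   Context: $\Delta x(n)=x(n+1)-x(n)$. Let $w=-\min_{n\ge0,\,1\le i\le m}\tau_i(n)$ (a finite positive integer). A solution of the equation is a real sequence $(x(n))_{n\ge -w}$ satisfying the equation for all $n\ge 0$. A solution is oscillatory (oscillates) if it is neither eventually positive nor eventually negative. *)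

theory Defs
  imports Complex_Main "HOL-Library.Extended_Real"
begin

definition fwd_diff :: "(int \<Rightarrow> real) \<Rightarrow> int \<Rightarrow> real" where
  "fwd_diff x n = x (n + 1) - x n"

(* A sequence (x(n)) with n >= -w is encoded as a total function on int.  Since
   -w is the least value of the delayed arguments tau i n, the equation for n >= 0
   only reads x at arguments >= -w, so the values of x below -w are irrelevant
   both here and for oscillation. *)
definition is_solution ::
  "nat \<Rightarrow> (nat \<Rightarrow> nat \<Rightarrow> real) \<Rightarrow> (nat \<Rightarrow> nat \<Rightarrow> int) \<Rightarrow> (int \<Rightarrow> real) \<Rightarrow> bool" where
  "is_solution m p \<tau> x \<longleftrightarrow>
     (\<forall>n::nat. fwd_diff x (int n) + (\<Sum>i=1..m. p i n * x (\<tau> i n)) = 0)"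

definition eventually_positive :: "(int \<Rightarrow> real) \<Rightarrow> bool" where
  "eventually_positive x \<longleftrightarrow> (\<forall>\<^sub>F n in at_top. x n > 0)"

definition eventually_negative :: "(int \<Rightarrow> real) \<Rightarrow> bool" where
  "eventually_negative x \<longleftrightarrow> (\<forall>\<^sub>F n in at_top. x n < 0)"

definition oscillatory :: "(int \<Rightarrow> real) \<Rightarrow> bool" where
  "oscillatory x \<longleftrightarrow> \<not> eventually_positive x \<and> \<not> eventually_negative x"

(* The sum of p_i(j) over i = 1..m and j = tau_k(n)..n-1.  The lower limit tau_k(n)
   can be negative, where p_i is undefined (nat j = 0 for such j).  With bounded
   delays this happens only for finitely many n, so the lower limit of the sums as
   n tends to infinity is unaffected. *)
definition delay_sum ::
  "nat \<Rightarrow> (nat \<Rightarrow> nat \<Rightarrow> real) \<Rightarrow> (nat \<Rightarrow> nat \<Rightarrow> int) \<Rightarrow> nat \<Rightarrow> nat \<Rightarrow> real" where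
  "delay_sum m p \<tau> k n = (\<Sum>i=1..m. \<Sum>j=\<tau> k n..int n - 1. p i (nat j))"

end

theory Submission
  imports Defs
begin

text \<open>
  Let \<open>x\<close> be eventually positive, hence eventually decreasing, and suppose that
  \<open>x(\<tau>\<^sub>i(n)) \<ge> l x(n)\<close> for all \<open>i\<close> and all large \<open>n\<close>; initially \<open>l = 1\<close>.  With
  \<open>P(j) = \<Sum>\<^sub>i p\<^sub>i(j)\<close> the equation gives \<open>x(j + 1) \<le> (1 - l P(j)) x(j)\<close>.  Multiplying this over
  \<open>\<tau>\<^sub>k(n) \<le> j < n\<close> and optimising the product for a given value of \<open>\<Sum>\<^sub>j P(j)\<close> gives
  \<open>x(\<tau>\<^sub>k(n)) \<ge> \<rho> l x(n)\<close> with a fixed \<open>\<rho> > 1\<close>.  So \<open>l\<close> can be made arbitrarily large.  But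
  \<open>P(j) \<le> 1 / l\<close> by positivity of \<open>x(j + 1)\<close>, so the sums of \<open>P\<close> over the bounded delay windows
  tend to \<open>0\<close>, contradicting the hypothesis.
\<close>

text \<open>After taking logarithms, concavity of \<open>ln\<close> bounds every term by a tangent.
  All bounds are sharp when \<open>card A = M\<close> and every \<open>q j\<close> equals
  \<open>1 / (M + 1)\<close>, which explains the constant.\<close>

lemma prod_one_minus_times_sum_le:
  fixes q :: "'a \<Rightarrow> real" and M :: real
  assumes fin: "finite A" and M: "M > 0" and card: "real (card A) \<le> M"
    and q: "\<And>j. j \<in> A \<Longrightarrow> q j < 1" and pos: "sum q A > 0"
  shows "(\<Prod>j\<in>A. 1 - q j) * sum q A \<le> (M / (M + 1)) powr (M + 1)"
proof -
  define b where "b = M / (M + 1)"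
  define Q where "Q = sum q A"
  have b: "0 < b" and b1: "1 / b = 1 + 1 / M"
    using M by (simp_all add: b_def field_simps)
  have Q: "Q > 0" using pos by (simp add: Q_def)
  \<comment> \<open>This sign allows \<open>card A\<close> to be replaced by its upper bound
    \<open>M\<close> below; it is \<open>ln (1 + 1 / M) \<le> 1 / M\<close>.\<close>
  have slack: "0 \<le> ln b + 1 / M"
    using ln_add_one_self_le_self[of "1 / M"] M b1 ln_div[of 1 b] b by simp
  \<comment> \<open>The tangent to \<open>ln (1 - q)\<close> at \<open>q = 1 / (M + 1)\<close>, the common value of the factors at the optimum.\<close>
  have tangent: "ln (1 - q j) \<le> ln b + 1 / M - q j / b" if "j \<in> A" for j
  proof -
    have "ln ((1 - q j) / b) \<le> (1 - q j) / b - 1"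
      using q[OF that] b by (intro ln_le_minus_one) simp
    then show ?thesis
      using q[OF that] b b1 ln_div[of "1 - q j" b] by (simp add: diff_divide_distrib[of 1])
  qed
  have "ln ((\<Prod>j\<in>A. 1 - q j) * Q) = (\<Sum>j\<in>A. ln (1 - q j)) + ln Q"
    using q Q by (simp add: ln_mult ln_prod[OF fin] prod_pos less_imp_neq[symmetric] fin)
  also have "\<dots> \<le> (\<Sum>j\<in>A. ln b + 1 / M - q j / b) + ln Q"
    using tangent by (intro add_right_mono sum_mono)
  also have "\<dots> = real (card A) * (ln b + 1 / M) - Q / b + ln Q"
    by (simp add: sum_subtractf Q_def sum_divide_distrib)
  also have "\<dots> \<le> M * (ln b + 1 / M) - Q / b + ln Q"
    using mult_right_mono[OF card slack] by simp
  also have "\<dots> = M * ln b + 1 - Q / b + ln (Q / b) + ln b"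
    using M b Q by (simp add: ln_div algebra_simps)
  \<comment> \<open>\<open>ln t \<le> t - 1\<close> at \<open>t = Q / b\<close>; the optimal sum is
    \<open>M / (M + 1) = b\<close>.\<close>
  also have "\<dots> \<le> (M + 1) * ln b"
    using ln_le_minus_one[of "Q / b"] b Q by (simp add: algebra_simps)
  also have "\<dots> = ln (b powr (M + 1))"
    using b by (simp add: ln_powr)
  finally have "ln ((\<Prod>j\<in>A. 1 - q j) * Q) \<le> ln (b powr (M + 1))" .
  moreover have "(\<Prod>j\<in>A. 1 - q j) * Q > 0"
    using q Q by (intro mult_pos_pos prod_pos) auto
  moreover have "b powr (M + 1) > 0"
    using b by simp
  ultimately show ?thesis
    unfolding b_def Q_def by (simp only: ln_le_cancel_iff)
qed

lemma le_mult_prod_of_step_le: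
  fixes y r :: "nat \<Rightarrow> real"
  assumes "a \<le> n" and "\<And>j. a \<le> j \<Longrightarrow> j < n \<Longrightarrow> 0 \<le> r j"
    and "\<And>j. a \<le> j \<Longrightarrow> j < n \<Longrightarrow> y (Suc j) \<le> y j * r j"
  shows "y n \<le> y a * (\<Prod>j=a..<n. r j)"
  using assms
proof (induction n rule: dec_induct)
  case base
  then show ?case by simp
next
  case (step n)
  have "y (Suc n) \<le> y n * r n"
    using step by simp
  also have "\<dots> \<le> (y a * (\<Prod>j=a..<n. r j)) * r n"
    using step by (intro mult_right_mono) auto
  finally show ?case
    using step by (simp add: mult.assoc)
qed

text \<open>The core argument, started late enough that delayed arguments are natural numbers and
  the lower limits have become uniform bounds \<open>S i\<close> with a strict gap.\<close>

lemma no_positive_solution: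
  fixes y :: "nat \<Rightarrow> real" and p :: "'i \<Rightarrow> nat \<Rightarrow> real" and \<sigma> :: "'i \<Rightarrow> nat \<Rightarrow> nat"
    and M S :: "'i \<Rightarrow> real"
  assumes I: "finite I" "I \<noteq> {}"
    and p: "\<And>i n. i \<in> I \<Longrightarrow> p i n \<ge> 0"
    and M: "\<And>i. i \<in> I \<Longrightarrow> M i > 0"
    and delay: "\<And>i n. i \<in> I \<Longrightarrow> n \<ge> N \<Longrightarrow> \<sigma> i n < n \<and> real n \<le> real (\<sigma> i n) + M i"
    and eq: "\<And>n. n \<ge> N \<Longrightarrow> y (Suc n) - y n + (\<Sum>i\<in>I. p i n * y (\<sigma> i n)) = 0"
    and S: "\<And>i. i \<in> I \<Longrightarrow> S i > (M i / (M i + 1)) powr (M i + 1)"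
    and window: "\<And>i n. i \<in> I \<Longrightarrow> n \<ge> N \<Longrightarrow> (\<Sum>j=\<sigma> i n..<n. \<Sum>i\<in>I. p i j) \<ge> S i"
    and pos: "\<And>n. n \<ge> N \<Longrightarrow> y n > 0"
  shows False
proof -
  define P where "P j = (\<Sum>i\<in>I. p i j)" for j
  define c where "c i = (M i / (M i + 1)) powr (M i + 1)" for i
  \<comment> \<open>A common bound for all delays: going \<open>W\<close> further puts every delayed
    argument past a given index.\<close>
  define W where "W = nat \<lceil>Max (M ` I)\<rceil>"
  have W: "M i \<le> real W" if "i \<in> I" for i
    using Max_ge[of "M ` I" "M i"] I that unfolding W_def by (auto intro: order_trans[OF _ real_nat_ceiling_ge])
  have \<sigma>_ge: "K \<le> \<sigma> i n" if "i \<in> I" "N \<le> n" "K + W \<le> n" for i n K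
    using delay[OF that(1,2)] W[OF that(1)] that(3) by linarith
  have P_nonneg: "P j \<ge> 0" for j
    using p by (simp add: P_def sum_nonneg)
  have c_pos: "c i > 0" if "i \<in> I" for i
    using M[OF that] by (simp add: c_def)

  \<comment> \<open>The gain per round in the worst case over \<open>i\<close>; it exceeds 1 because
    \<open>I\<close> is finite.\<close>
  define \<rho> where "\<rho> = Min ((\<lambda>i. S i / c i) ` I)"
  have \<rho>: "\<rho> > 1"
    using I S c_pos by (simp add: \<rho>_def c_def)
  have \<rho>_le: "\<rho> * c i \<le> S i" if "i \<in> I" for i
  proof -
    have "\<rho> \<le> S i / c i"
      using I that by (simp add: \<rho>_def)
    then show ?thesis
      using c_pos[OF that] by (simp add: field_simps)
  qed

  define ratio where "ratio l K \<longleftrightarrow> (\<forall>n\<ge>K. \<forall>i\<in>I. l * y n \<le> y (\<sigma> i n))" for l K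
  have step: "y (Suc j) \<le> y j * (1 - l * P j)" if "ratio l K" "j \<ge> K" "j \<ge> N" for l K j
  proof -
    have "(\<Sum>i\<in>I. p i j * (l * y j)) \<le> (\<Sum>i\<in>I. p i j * y (\<sigma> i j))"
      using that p by (intro sum_mono mult_left_mono) (auto simp: ratio_def)
    then have "P j * (l * y j) \<le> (\<Sum>i\<in>I. p i j * y (\<sigma> i j))"
      by (simp add: P_def sum_distrib_right)
    then show ?thesis
      using eq[OF that(3)] by (simp add: algebra_simps)
  qed
  have lP: "l * P j < 1" if "ratio l K" "j \<ge> K" "j \<ge> N" for l K j
  proof -
    have "0 < y j * (1 - l * P j)"
      using step[OF that] pos[of "Suc j"] that(3) by linarith
    then show ?thesis
      using pos[OF that(3)] by (simp add: zero_less_mult_iff)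
  qed

  \<comment> \<open>The first \<open>W\<close> makes the delayed values positive, so that
    \<open>y\<close> decreases; the second keeps the whole window in that range.\<close>
  have base: "ratio 1 (N + W + W)"
    unfolding ratio_def
  proof (intro allI impI ballI)
    fix n i assume n: "N + W + W \<le> n" and i: "i \<in> I"
    have "y (Suc j) \<le> y j" if j: "j \<ge> N + W" for j
    proof -
      have "(\<Sum>i\<in>I. p i j * y (\<sigma> i j)) \<ge> 0"
        using p pos \<sigma>_ge[of _ j N] j by (intro sum_nonneg mult_nonneg_nonneg) (auto intro: less_imp_le)
      then show ?thesis using eq[of j] j by simp
    qed
    then have "y n \<le> y (\<sigma> i n) * (\<Prod>j=\<sigma> i n..<n. 1)"
      using \<sigma>_ge[OF i, of n "N + W"] delay[OF i, of n] n by (intro le_mult_prod_of_step_le) auto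
    then show "1 * y n \<le> y (\<sigma> i n)" by simp
  qed

  have amplify: "ratio (\<rho> * l) (N + K + W)" if r: "ratio l K" and l: "l > 0" for l K
    unfolding ratio_def
  proof (intro allI impI ballI)
    fix n k assume n: "N + K + W \<le> n" and k: "k \<in> I"
    define A where "A = {\<sigma> k n..<n}"
    define Q where "Q = (\<Sum>j\<in>A. l * P j)"
    have d: "\<sigma> k n < n" "real n \<le> real (\<sigma> k n) + M k" "N + K \<le> \<sigma> k n"
      using delay[OF k, of n] \<sigma>_ge[OF k, of n "N + K"] n by auto
    have "\<rho> * c k \<le> (\<Sum>j\<in>A. P j)"
      using \<rho>_le[OF k] window[OF k, of n] n by (simp add: A_def P_def)
    then have Q: "\<rho> * c k * l \<le> Q"
      using l by (simp add: Q_def sum_distrib_left[symmetric])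
    have Q_pos: "Q > 0"
      using \<rho> c_pos[OF k] l by (intro less_le_trans[OF _ Q]) simp
    have "y n \<le> y (\<sigma> k n) * (\<Prod>j\<in>A. 1 - l * P j)"
      unfolding A_def using d step[OF r] lP[OF r]
      by (intro le_mult_prod_of_step_le) (auto simp: less_imp_le)
    moreover have "(\<Prod>j\<in>A. 1 - l * P j) * Q \<le> c k"
      unfolding Q_def c_def
      using d lP[OF r] M[OF k] Q_pos by (intro prod_one_minus_times_sum_le) (auto simp: A_def Q_def)
    moreover have "y (\<sigma> k n) > 0"
      using d pos by simp
    \<comment> \<open>The factor \<open>Q\<close> turns the product into \<open>c k\<close>; since
      \<open>Q\<close> is at least \<open>\<rho> * c k * l\<close>, cancelling \<open>c k\<close>
      leaves the gain \<open>\<rho> * l\<close>.\<close>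
    ultimately have "y n * Q \<le> y (\<sigma> k n) * c k"
      using Q_pos by (smt (verit) mult.assoc mult_left_mono mult_right_mono)
    moreover have "y n * (\<rho> * c k * l) \<le> y n * Q"
      using Q pos[of n] n by (intro mult_left_mono) auto
    ultimately have "(\<rho> * l * y n) * c k \<le> y (\<sigma> k n) * c k"
      by (simp add: algebra_simps)
    then show "\<rho> * l * y n \<le> y (\<sigma> k n)"
      using c_pos[OF k] by simp
  qed

  have powers: "\<exists>K. ratio (\<rho> ^ e) K" for e
  proof (induction e)
    case 0
    then show ?case using base by auto
  next
    case (Suc e)
    then show ?case using amplify[of "\<rho> ^ e"] \<rho> by auto
  qed

  obtain k where k: "k \<in> I" using I by blast
  have Sk: "S k > 0" using S[OF k] c_pos[OF k] unfolding c_def by linarith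
  \<comment> \<open>For this \<open>e\<close> the weighted window sum exceeds \<open>M k\<close>,
    yet it has at most \<open>M k\<close> terms, each below 1 by \<open>lP\<close>.\<close>
  obtain e where e: "M k / S k < \<rho> ^ e"
    using real_arch_pow[OF \<rho>] by blast
  obtain K where K: "ratio (\<rho> ^ e) K" using powers by blast
  define n where "n = N + K + W"
  have d: "\<sigma> k n < n" "real n \<le> real (\<sigma> k n) + M k" "N + K \<le> \<sigma> k n"
    using delay[OF k, of n] \<sigma>_ge[OF k, of n "N + K"] by (auto simp: n_def)
  have "\<rho> ^ e * S k \<le> (\<Sum>j=\<sigma> k n..<n. \<rho> ^ e * P j)"
    using window[OF k, of n] \<rho> by (simp add: P_def n_def sum_distrib_left[symmetric])
  also have "\<dots> \<le> (\<Sum>j=\<sigma> k n..<n. 1)"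
    using lP[OF K] d by (intro sum_mono) (auto simp: less_imp_le)
  also have "\<dots> \<le> M k" using d by simp
  finally show False
    using e Sk by (simp add: field_simps)
qed

text \<open>By linearity; this reduces eventually negative solutions to eventually positive
  ones.\<close>

lemma is_solution_uminus:
  "is_solution m p \<tau> x \<Longrightarrow> is_solution m p \<tau> (\<lambda>n. - x n)"
  unfolding is_solution_def fwd_diff_def by (simp add: sum_negf) (smt (verit))

theorem theorem3p3:
  fixes m :: nat
    and p :: "nat \<Rightarrow> nat \<Rightarrow> real"
    and \<tau> :: "nat \<Rightarrow> nat \<Rightarrow> int"
    and M :: "nat \<Rightarrow> real"
  assumes "m \<ge> 1"
    and "\<And>i n. i \<in> {1..m} \<Longrightarrow> p i n \<ge> 0"
    and "\<And>i n. i \<in> {1..m} \<Longrightarrow> \<tau> i n \<le> int n - 1"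
    and "\<And>i. i \<in> {1..m} \<Longrightarrow> M i > 0"
    and "\<And>i n. i \<in> {1..m} \<Longrightarrow> real_of_int (int n - \<tau> i n) \<le> M i"
    and "\<And>k. k \<in> {1..m} \<Longrightarrow>
           liminf (\<lambda>n. ereal (delay_sum m p \<tau> k n)) > ereal ((M k / (M k + 1)) powr (M k + 1))"
  shows "\<forall>x. is_solution m p \<tau> x \<longrightarrow> oscillatory x"
proof -
  have not_pos: "\<not> eventually_positive x" if sol: "is_solution m p \<tau> x" for x
  proof
    assume "eventually_positive x"
    then obtain B where B: "\<And>n. n \<ge> B \<Longrightarrow> x n > 0"
      unfolding eventually_positive_def eventually_at_top_linorder by blast
    have "\<exists>s. (M k / (M k + 1)) powr (M k + 1) < s \<and> (\<forall>\<^sub>F n in sequentially. s < delay_sum m p \<tau> k n)"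
      if k: "k \<in> {1..m}" for k
    proof -
      obtain s where "ereal ((M k / (M k + 1)) powr (M k + 1)) < ereal s"
        "ereal s < liminf (\<lambda>n. ereal (delay_sum m p \<tau> k n))"
        using ereal_dense2[OF assms(6)[OF k]] by blast
      then show ?thesis
        using less_LiminfD[of "ereal s"] by fastforce
    qed
    then obtain S where S: "\<And>k. k \<in> {1..m} \<Longrightarrow> (M k / (M k + 1)) powr (M k + 1) < S k"
      and "\<And>k. k \<in> {1..m} \<Longrightarrow> \<forall>\<^sub>F n in sequentially. S k < delay_sum m p \<tau> k n"
      by metis
    then have "\<forall>\<^sub>F n in sequentially. \<forall>k\<in>{1..m}. S k < delay_sum m p \<tau> k n"
      by (simp add: eventually_ball_finite)
    then obtain N where N: "\<And>n k. n \<ge> N \<Longrightarrow> k \<in> {1..m} \<Longrightarrow> S k < delay_sum m p \<tau> k n"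
      unfolding eventually_sequentially by blast
    define W where "W = nat \<lceil>Max (M ` {1..m})\<rceil>"
    have W: "M i \<le> real W" if "i \<in> {1..m}" for i
      using Max_ge[of "M ` {1..m}" "M i"] that unfolding W_def
      by (auto intro: order_trans[OF _ real_nat_ceiling_ge])
    \<comment> \<open>Past \<open>B\<close> the solution is positive, past \<open>N\<close> the
      window bounds hold, and past \<open>W\<close> no delayed argument is negative, so
      \<open>nat\<close> does not truncate.\<close>
    define L where "L = max (nat B) (max N W)"
    have \<tau>_nonneg: "\<tau> i n \<ge> 0" if "i \<in> {1..m}" "n \<ge> L" for i n
      using assms(5)[OF that(1), of n] W[OF that(1)] that(2) by (simp add: L_def)
    show False
    proof (rule no_positive_solution[where I = "{1..m}" and y = "\<lambda>n. x (int n)" and p = p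
          and \<sigma> = "\<lambda>i n. nat (\<tau> i n)" and M = M and S = S and N = L])
      fix i n assume i: "i \<in> {1..m}" and n: "L \<le> n"
      show "nat (\<tau> i n) < n \<and> real n \<le> real (nat (\<tau> i n)) + M i"
        using assms(3,5)[OF i, of n] \<tau>_nonneg[OF i n] by simp
      have "{\<tau> i n..int n - 1} = int ` {nat (\<tau> i n)..<n}"
        using \<tau>_nonneg[OF i n] by (auto simp: image_int_atLeastLessThan)
      then have "delay_sum m p \<tau> i n = (\<Sum>j=nat (\<tau> i n)..<n. \<Sum>i\<in>{1..m}. p i j)"
        unfolding delay_sum_def by (subst sum.swap) (simp add: sum.reindex)
      then show "S i \<le> (\<Sum>j=nat (\<tau> i n)..<n. \<Sum>i\<in>{1..m}. p i j)"
        using N[OF _ i, of n] n by (simp add: L_def)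
    next
      fix n assume n: "L \<le> n"
      then show "x (int n) > 0"
        by (intro B) (auto simp: L_def nat_le_iff)
      have "(\<Sum>i=1..m. p i n * x (\<tau> i n)) = (\<Sum>i=1..m. p i n * x (int (nat (\<tau> i n))))"
        using \<tau>_nonneg n by (intro sum.cong) auto
      then show "x (int (Suc n)) - x (int n) + (\<Sum>i=1..m. p i n * x (int (nat (\<tau> i n)))) = 0"
        using spec[OF sol[unfolded is_solution_def fwd_diff_def], of n] by (simp add: add.commute)
    qed (use assms S in auto)
  qed
  show ?thesis
  proof (intro allI impI)
    fix x assume "is_solution m p \<tau> x"
    then show "oscillatory x"
      using not_pos[of x] not_pos[OF is_solution_uminus, of x]
      by (simp add: oscillatory_def eventually_positive_def eventually_negative_def)
  qed
qed

end
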